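(* Let $L\colon[a,b]\times\mathbb{R}^{n}\times\mathbb{R}^n\to\mathbb{R}^d$ be of class $C^1$ and let $M\subseteq\mathcal{X}$ be an infimizer for $\overline J$. Then for every $\zeta\in C^+\setminus\{0\}$ one has $$\inf_{y\in M}J_\zeta(y)=\inf_{y\in\mathcal{X}}J_\zeta(y),$$ and consequently, for every $\zeta\in C^+\setminus\{0\}$, the set $M$ contains either an arc $y_\zeta$ with $J_\zeta(y_\zeta)=\inf_{y\in\mathcal{X}}J_\zeta(y)$, or a sequence $\{y_{m,\zeta}\}_{m\in\mathbb{N}}\subseteq M$ such that $\lim_{m\to+\infty}J_\zeta(y_{m,\zeta})=\inf_{y\in\mathcal{X}}J_\zeta(y)$ (the infimum may be $-\infty$).
   Context: Let $a<b$ be real, $n\ge 1$, $d>1$ integers, $A,B\in\mathbb{R}^n$, and let $\emptyset\neq C\subsetneq\mathbb{R}^d$ be a closed convex cone with dual $C^+=\{\zeta\in\mathbb{R}^d\mid \zeta\cdot z\ge 0\ \forall z\in C\}$. Put $\mathcal{X}=\{y\in C^1([a,b];\mathbb{R}^n)\mid y(a)=A,\ y(b)=B\}$, $J(y)=\int_a^bL(t,y(t),\dot y(t))\,dt\in\mathbb{R}^d$, $\overline J(y)=J(y)+C\subseteq\mathbb{R}^d$, and $J_\zeta(y)=\zeta\cdot J(y)$. For closed sets $A'\subseteq\mathbb{R}^d$ with $A'=\mathrm{cl}(A'+C)$, ordered by $\supseteq$, the infimum of a family is the closure of its union; thus for $N\subseteq\mathcal{X}$, $\inf\overline J[N]=\mathrm{cl}\bigcup_{y\in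 N}\overline J(y)$. A set $M\subseteq\mathcal{X}$ is an infimizer for $\overline J$ if $\inf\overline J[M]=\inf\overline J[\mathcal{X}]$. *)

theory Defs
  imports "HOL-Analysis.Analysis"
begin

definition dual_cone :: "'a::real_inner set \<Rightarrow> 'a set" where
  "dual_cone C = {\<zeta>. \<forall>z\<in>C. \<zeta> \<bullet> z \<ge> 0}"

(* Frechet C1 on an arbitrary set. It is used for the strip [a,b] x R^n x R^n with a < b, where the
   derivative within the set is unique (and one-sided in t at the two end points). *)
definition C1_on :: "('a::real_normed_vector \<Rightarrow> 'b::real_normed_vector) \<Rightarrow> 'a set \<Rightarrow> bool" where
  "C1_on f S \<longleftrightarrow>
     (\<exists>f'. (\<forall>x\<in>S. (f has_derivative blinfun_apply (f' x)) (at x within S)) \<and> continuous_on S f')"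

(* Not the library's C1_differentiable_on, which asks for two-sided derivatives also at a and b and
   would thus depend on values of y outside [a,b]. Arcs are total functions; what they do outside
   [a,b] is unconstrained and enters neither this set nor the functional below. *)
definition admissible_arcs ::
    "real \<Rightarrow> real \<Rightarrow> 'v \<Rightarrow> 'v \<Rightarrow> (real \<Rightarrow> 'v::real_normed_vector) set" where
  "admissible_arcs a b A B =
     {y. (\<exists>y'. (\<forall>t\<in>{a..b}. (y has_vector_derivative y' t) (at t within {a..b})) \<and>
               continuous_on {a..b} y') \<and>
         y a = A \<and> y b = B}"

definition functional_J ::
    "real \<Rightarrow> real \<Rightarrow> (real \<Rightarrow> 'v::real_normed_vector \<Rightarrow> 'v \<Rightarrow> 'w::euclidean_space) \<Rightarrow>
     (real \<Rightarrow> 'v) \<Rightarrow> 'w" where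
  "functional_J a b L y =
     integral {a..b} (\<lambda>t. L t (y t) (vector_derivative y (at t within {a..b})))"

definition functional_Jbar ::
    "real \<Rightarrow> real \<Rightarrow> (real \<Rightarrow> 'v::real_normed_vector \<Rightarrow> 'v \<Rightarrow> 'w::euclidean_space) \<Rightarrow> 'w set \<Rightarrow>
     (real \<Rightarrow> 'v) \<Rightarrow> 'w set" where
  "functional_Jbar a b L C y = (\<lambda>c. functional_J a b L y + c) ` C"

(* Infimum of F[N] in the lattice of the sets A with A = closure (A + C), ordered by reverse
   inclusion. *)
definition set_infimum :: "('x \<Rightarrow> 'w::topological_space set) \<Rightarrow> 'x set \<Rightarrow> 'w set" where
  "set_infimum F N = closure (\<Union>y\<in>N. F y)"

definition infimizer ::
    "('x \<Rightarrow> 'w::topological_space set) \<Rightarrow> 'x set \<Rightarrow> 'x set \<Rightarrow> bool" where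
  "infimizer F X M \<longleftrightarrow> M \<subseteq> X \<and> set_infimum F M = set_infimum F X"

end

theory Submission
  imports Defs
begin

text \<open>Since \<open>\<zeta>\<close> is nonnegative on the cone and the cone contains 0, the infimum of \<open>\<zeta> \<bullet> J\<close> over
  a family of arcs is the infimum of the continuous function \<open>z \<mapsto> \<zeta> \<bullet> z\<close> over the set-valued
  infimum of that family. Hence it only depends on the latter.\<close>

lemma INF_closure:
  fixes f :: "'a::topological_space \<Rightarrow> ereal"
  assumes "continuous_on UNIV f"
  shows "(INF z\<in>closure S. f z) = (INF z\<in>S. f z)"
proof (rule antisym)
  show "(INF z\<in>closure S. f z) \<le> (INF z\<in>S. f z)"
    by (rule INF_superset_mono) (auto simp: closure_subset)
  \<comment> \<open>The superlevel set of \<open>f\<close> at the height of its infimum over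
    \<open>S\<close> is closed by continuity and contains \<open>S\<close>, hence also
    \<open>closure S\<close>. This argument covers an infimum of minus infinity as well.\<close>
  have "closed {z. (INF z\<in>S. f z) \<le> f z}"
    using assms by (intro closed_Collect_le) auto
  then have "closure S \<subseteq> {z. (INF z\<in>S. f z) \<le> f z}"
    by (intro closure_minimal) (auto intro: INF_lower)
  then show "(INF z\<in>S. f z) \<le> (INF z\<in>closure S. f z)"
    by (auto intro: INF_greatest)
qed

lemma INF_inner_set_infimum:
  fixes C :: "'w::euclidean_space set"
  assumes "0 \<in> C" and "\<zeta> \<in> dual_cone C"
  shows "(INF z\<in>set_infimum (functional_Jbar a b L C) N. ereal (\<zeta> \<bullet> z)) =
         (INF y\<in>N. ereal (\<zeta> \<bullet> functional_J a b L y))"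
proof -
  let ?U = "\<Union>y\<in>N. functional_Jbar a b L C y"
  have "(INF z\<in>set_infimum (functional_Jbar a b L C) N. ereal (\<zeta> \<bullet> z)) =
        (INF z\<in>?U. ereal (\<zeta> \<bullet> z))"
    unfolding set_infimum_def by (intro INF_closure continuous_intros)
  also have "\<dots> = (INF y\<in>N. ereal (\<zeta> \<bullet> functional_J a b L y))"
  proof (rule antisym)
    \<comment> \<open>Take the cone element 0 in \<open>functional_J a b L y + c\<close>.\<close>
    have "functional_J a b L y \<in> ?U" if "y \<in> N" for y
      using that \<open>0 \<in> C\<close> unfolding functional_Jbar_def by force
    then show "(INF z\<in>?U. ereal (\<zeta> \<bullet> z)) \<le> (INF y\<in>N. ereal (\<zeta> \<bullet> functional_J a b L y))"
      by (intro INF_greatest INF_lower)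
    show "(INF y\<in>N. ereal (\<zeta> \<bullet> functional_J a b L y)) \<le> (INF z\<in>?U. ereal (\<zeta> \<bullet> z))"
    proof (rule INF_greatest)
      fix z assume "z \<in> ?U"
      then obtain y c where "y \<in> N" "c \<in> C" and z: "z = functional_J a b L y + c"
        unfolding functional_Jbar_def by auto
      \<comment> \<open>The difference of the two sides is \<open>\<zeta> \<bullet> c\<close>,
        nonnegative because \<open>\<zeta>\<close> lies in the dual cone.\<close>
      then have "\<zeta> \<bullet> functional_J a b L y \<le> \<zeta> \<bullet> z"
        using assms(2) by (auto simp: dual_cone_def inner_add_right)
      with \<open>y \<in> N\<close> show "(INF y\<in>N. ereal (\<zeta> \<bullet> functional_J a b L y)) \<le> ereal (\<zeta> \<bullet> z)"
        by (intro INF_lower2) auto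
    qed
  qed
  finally show ?thesis .
qed

lemma admissible_arcs_nonempty:
  assumes "a < b"
  shows "admissible_arcs a b A B \<noteq> {}"
proof -
  \<comment> \<open>The straight segment from \<open>A\<close> to \<open>B\<close>, run through at
    constant velocity.\<close>
  define y where "y t = A + ((t - a) / (b - a)) *\<^sub>R (B - A)" for t
  have "(y has_vector_derivative (1 / (b - a)) *\<^sub>R (B - A)) (at t within {a..b})" for t
    unfolding y_def using assms by (auto intro!: derivative_eq_intros)
  then have "y \<in> admissible_arcs a b A B"
    using assms unfolding admissible_arcs_def
    by (auto simp: y_def intro!: exI[of _ "\<lambda>_. (1 / (b - a)) *\<^sub>R (B - A)"])
  then show ?thesis by blast
qed

text \<open>An empty \<open>M\<close> would have the empty set as its infimum, and a closure is
  empty only if the set itself is. Nonemptiness is what allows a minimizing sequence to be chosen in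
  \<open>M\<close>.\<close>

lemma infimizer_nonempty:
  assumes "infimizer F X M" and "X \<noteq> {}" and "\<And>x. x \<in> X \<Longrightarrow> F x \<noteq> {}"
  shows "M \<noteq> {}"
proof
  assume "M = {}"
  with assms(1) have "\<Union>(F ` X) = {}"
    by (simp add: infimizer_def set_infimum_def flip: closure_eq_empty)
  with assms(2,3) show False by blast
qed

theorem mainTheorem1:
  fixes a b :: real
    and A B :: "real ^ 'n"
    and C :: "(real ^ 'd) set"
    and L :: "real \<Rightarrow> real ^ 'n \<Rightarrow> real ^ 'n \<Rightarrow> real ^ 'd"
    and M :: "(real \<Rightarrow> real ^ 'n) set"
  assumes "a < b"
    and "CARD('d) > 1"
    and "C \<noteq> {}" and "C \<noteq> UNIV" and "closed C" and "convex C" and "cone C"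
    and "C1_on (\<lambda>(t, x, v). L t x v) ({a..b} \<times> UNIV \<times> UNIV)"
    and "infimizer (functional_Jbar a b L C) (admissible_arcs a b A B) M"
  shows "(\<forall>\<zeta> \<in> dual_cone C - {0}.
            (INF y\<in>M. ereal (\<zeta> \<bullet> functional_J a b L y)) =
            (INF y\<in>admissible_arcs a b A B. ereal (\<zeta> \<bullet> functional_J a b L y))) \<and>
         (\<forall>\<zeta> \<in> dual_cone C - {0}.
            (\<exists>y\<in>M. ereal (\<zeta> \<bullet> functional_J a b L y) =
                   (INF y\<in>admissible_arcs a b A B. ereal (\<zeta> \<bullet> functional_J a b L y))) \<or>
            (\<exists>ys :: nat \<Rightarrow> real \<Rightarrow> real ^ 'n. (\<forall>m. ys m \<in> M) \<and>
                   (\<lambda>m. ereal (\<zeta> \<bullet> functional_J a b L (ys m))) \<longlonglongrightarrow>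
                   (INF y\<in>admissible_arcs a b A B. ereal (\<zeta> \<bullet> functional_J a b L y))))"
proof -
  let ?J = "functional_J a b L" and ?X = "admissible_arcs a b A B"
  have C0: "0 \<in> C"
    using \<open>cone C\<close> \<open>C \<noteq> {}\<close> by (simp add: cone_contains_0)
  have "M \<noteq> {}"
    using assms(9)
    by (rule infimizer_nonempty)
      (use assms(1,3) in \<open>auto simp: admissible_arcs_nonempty functional_Jbar_def\<close>)
  \<comment> \<open>Both sides become infima of \<open>\<zeta> \<bullet> z\<close> over set-valued
    infima, and these coincide because \<open>M\<close> is an infimizer.\<close>
  have eq: "(INF y\<in>M. ereal (\<zeta> \<bullet> ?J y)) = (INF y\<in>?X. ereal (\<zeta> \<bullet> ?J y))"
    if "\<zeta> \<in> dual_cone C" for \<zeta>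
    using assms(9) by (simp add: infimizer_def flip: INF_inner_set_infimum[OF C0 that])
  \<comment> \<open>The disjunction is settled by its second alternative: a minimizing sequence
    exists whether or not the infimum is attained.\<close>
  moreover have "\<exists>ys. (\<forall>m. ys m \<in> M) \<and>
      (\<lambda>m. ereal (\<zeta> \<bullet> ?J (ys m))) \<longlonglongrightarrow> (INF y\<in>?X. ereal (\<zeta> \<bullet> ?J y))"
    if "\<zeta> \<in> dual_cone C" for \<zeta>
  proof -
    obtain u :: "nat \<Rightarrow> ereal" where u: "\<And>m. u m \<in> (\<lambda>y. ereal (\<zeta> \<bullet> ?J y)) ` M"
      and lim: "u \<longlonglongrightarrow> (INF y\<in>M. ereal (\<zeta> \<bullet> ?J y))"
      using Inf_as_limit[of "(\<lambda>y. ereal (\<zeta> \<bullet> ?J y)) ` M"] \<open>M \<noteq> {}\<close> by auto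
    \<comment> \<open>Choice lifts the sequence of values to a sequence of arcs in
      \<open>M\<close>.\<close>
    from u obtain ys where "\<And>m. ys m \<in> M" and "\<And>m. u m = ereal (\<zeta> \<bullet> ?J (ys m))"
      unfolding image_iff by metis
    moreover from this have "u = (\<lambda>m. ereal (\<zeta> \<bullet> ?J (ys m)))"
      by auto
    ultimately show ?thesis
      using lim eq[OF that] by auto
  qed
  ultimately show ?thesis
    by blast
qed

end
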